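(* The following eight equations are sufficient to characterize the variety of rectangular quasigroups; that is, an algebra $\mathcal{M} = (M;\,\cdot,\backslash,/)$ with three binary operations is a rectangular quasigroup if and only if it satisfies, for all $x,y,z\in M$: (Q1) $x\backslash (xx) = x$; (Q2) $(xx)/ x = x$; (Q3) $x (x\backslash y) = x\backslash (xy)$; (Q4) $(x/ y) y = (xy)/ y$; (K6) $(x\backslash y) \backslash \big((x\backslash y) z\big) = x \backslash (xz)$; (K12) $\big(x (y/ z)\big) / (y/ z) = (xz)/ z$; (K14) $\big(x \backslash (xy)\big)z = x \backslash \big(x(yz)\big)$; (K15) $x \big((yz)/ z\big) = \big((xy)z\big)/ z$.
   Context: Juxtaposition denotes the operation $\cdot$, that is, $xy = x\cdot y$. A quasigroup is an algebra $(Q;\,\cdot,\backslash,/)$ with three binary operations satisfying $x\backslash(xy)=y$, $x(x\backslash y)=y$, $(xy)/y = x$, and $(x/y)y=x$. A left zero semigroup is a semigroup satisfying $xy = x$; a right zero semigroup is a semigroup satisfying $xy=y$. A rectangular band is a semigroup that is (isomorphic to) a direct product of a left zero semigroup and a right zero semigroup; it is regarded as an algebra with three binary operations by setting $x\backslash y = x/y = xy$. A rectangular quasigroup is an algebra $(M;\,\cdot,\backslash,/)$ that is (isomorphic to) the direct product, as algebras with three binary operations, of a quasigroup and a rectangular band. *)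

theory Defs
  imports Main
begin

text \<open>
  Algebras are given by an explicit carrier set, with the operations relativised to it.  As usual
  for varieties, an empty carrier is not excluded.  In \<open>x \<setminus> y\<close> the divisor is on the left, in
  \<open>x \<oslash> y\<close> (for \<open>x / y\<close>) it is on the right.
\<close>

record 'a magma =
  carrier :: "'a set"
  mult :: "'a \<Rightarrow> 'a \<Rightarrow> 'a" (infixl "\<cdot>\<index>" 70)

record 'a algebra3 = "'a magma" +
  ldiv :: "'a \<Rightarrow> 'a \<Rightarrow> 'a" (infixl "\<setminus>\<index>" 70)
  rdiv :: "'a \<Rightarrow> 'a \<Rightarrow> 'a" (infixl "\<oslash>\<index>" 70)

locale magma =
  fixes M (structure)
  assumes mult_closed: "\<lbrakk>x \<in> carrier M; y \<in> carrier M\<rbrakk> \<Longrightarrow> x \<cdot> y \<in> carrier M"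

locale semigrp = magma +
  assumes mult_assoc:
    "\<lbrakk>x \<in> carrier M; y \<in> carrier M; z \<in> carrier M\<rbrakk> \<Longrightarrow> (x \<cdot> y) \<cdot> z = x \<cdot> (y \<cdot> z)"

locale left_zero_semigroup = semigrp +
  assumes left_zero: "\<lbrakk>x \<in> carrier M; y \<in> carrier M\<rbrakk> \<Longrightarrow> x \<cdot> y = x"

locale right_zero_semigroup = semigrp +
  assumes right_zero: "\<lbrakk>x \<in> carrier M; y \<in> carrier M\<rbrakk> \<Longrightarrow> x \<cdot> y = y"

locale algebra3 = magma +
  assumes ldiv_closed: "\<lbrakk>x \<in> carrier M; y \<in> carrier M\<rbrakk> \<Longrightarrow> x \<setminus> y \<in> carrier M"
    and rdiv_closed: "\<lbrakk>x \<in> carrier M; y \<in> carrier M\<rbrakk> \<Longrightarrow> x \<oslash> y \<in> carrier M"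

locale quasigroup = algebra3 +
  assumes ldiv_mult: "\<lbrakk>x \<in> carrier M; y \<in> carrier M\<rbrakk> \<Longrightarrow> x \<setminus> (x \<cdot> y) = y"
    and mult_ldiv: "\<lbrakk>x \<in> carrier M; y \<in> carrier M\<rbrakk> \<Longrightarrow> x \<cdot> (x \<setminus> y) = y"
    and mult_rdiv: "\<lbrakk>x \<in> carrier M; y \<in> carrier M\<rbrakk> \<Longrightarrow> (x \<cdot> y) \<oslash> y = x"
    and rdiv_mult: "\<lbrakk>x \<in> carrier M; y \<in> carrier M\<rbrakk> \<Longrightarrow> (x \<oslash> y) \<cdot> y = x"

definition magma_prod ::
  "('a, 'm) magma_scheme \<Rightarrow> ('b, 'n) magma_scheme \<Rightarrow> ('a \<times> 'b) magma" where
  "magma_prod M N =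
    \<lparr>carrier = carrier M \<times> carrier N,
     mult = (\<lambda>p q. (fst p \<cdot>\<^bsub>M\<^esub> fst q, snd p \<cdot>\<^bsub>N\<^esub> snd q))\<rparr>"

definition algebra3_prod ::
  "('a, 'm) algebra3_scheme \<Rightarrow> ('b, 'n) algebra3_scheme \<Rightarrow> ('a \<times> 'b) algebra3" where
  "algebra3_prod M N =
    \<lparr>carrier = carrier M \<times> carrier N,
     mult = (\<lambda>p q. (fst p \<cdot>\<^bsub>M\<^esub> fst q, snd p \<cdot>\<^bsub>N\<^esub> snd q)),
     ldiv = (\<lambda>p q. (fst p \<setminus>\<^bsub>M\<^esub> fst q, snd p \<setminus>\<^bsub>N\<^esub> snd q)),
     rdiv = (\<lambda>p q. (fst p \<oslash>\<^bsub>M\<^esub> fst q, snd p \<oslash>\<^bsub>N\<^esub> snd q))\<rparr>"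

definition magma_iso ::
  "('a \<Rightarrow> 'b) \<Rightarrow> ('a, 'm) magma_scheme \<Rightarrow> ('b, 'n) magma_scheme \<Rightarrow> bool" where
  "magma_iso f M N \<longleftrightarrow>
    bij_betw f (carrier M) (carrier N) \<and>
    (\<forall>x\<in>carrier M. \<forall>y\<in>carrier M. f (x \<cdot>\<^bsub>M\<^esub> y) = f x \<cdot>\<^bsub>N\<^esub> f y)"

definition algebra3_iso ::
  "('a \<Rightarrow> 'b) \<Rightarrow> ('a, 'm) algebra3_scheme \<Rightarrow> ('b, 'n) algebra3_scheme \<Rightarrow> bool" where
  "algebra3_iso f M N \<longleftrightarrow>
    magma_iso f M N \<and>
    (\<forall>x\<in>carrier M. \<forall>y\<in>carrier M.
      f (x \<setminus>\<^bsub>M\<^esub> y) = f x \<setminus>\<^bsub>N\<^esub> f y \<and> f (x \<oslash>\<^bsub>M\<^esub> y) = f x \<oslash>\<^bsub>N\<^esub> f y)"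

text \<open>
  HOL cannot quantify over the element types of the factors, so the factors are sought with
  carriers inside the element type of the algebra itself.  This is no restriction: by
  \<open>rectangular_bandI\<close> and \<open>rectangular_quasigroupI\<close> below, factors over arbitrary element types
  do as well.
\<close>

definition rectangular_band :: "('a, 'm) magma_scheme \<Rightarrow> bool" where
  "rectangular_band B \<longleftrightarrow>
    semigrp B \<and>
    (\<exists>(L :: 'a magma) (R :: 'a magma) f.
      left_zero_semigroup L \<and> right_zero_semigroup R \<and> magma_iso f B (magma_prod L R))"

definition rectangular_band_algebra :: "('a, 'm) algebra3_scheme \<Rightarrow> bool" where
  "rectangular_band_algebra B \<longleftrightarrow>
    rectangular_band B \<and>
    (\<forall>x\<in>carrier B. \<forall>y\<in>carrier B. x \<setminus>\<^bsub>B\<^esub> y = x \<cdot>\<^bsub>B\<^esub> y \<and> x \<oslash>\<^bsub>B\<^esub> y = x \<cdot>\<^bsub>B\<^esub> y)"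

definition rectangular_quasigroup :: "('a, 'm) algebra3_scheme \<Rightarrow> bool" where
  "rectangular_quasigroup M \<longleftrightarrow>
    algebra3 M \<and>
    (\<exists>(Q :: 'a algebra3) (B :: 'a algebra3) f.
      quasigroup Q \<and> rectangular_band_algebra B \<and> algebra3_iso f M (algebra3_prod Q B))"

lemma rectangular_bandI:
  fixes B :: "('b, 'm) magma_scheme"
    and L :: "('l, 'n) magma_scheme" and R :: "('r, 'k) magma_scheme"
  assumes B: "semigrp B" and L: "left_zero_semigroup L" and R: "right_zero_semigroup R"
    and f: "magma_iso f B (magma_prod L R)"
  shows "rectangular_band B"
proof (cases "carrier B = {}")
  case True
  let ?E = "\<lparr>carrier = {} :: 'b set, mult = \<lambda>x y. x\<rparr>"
  have "left_zero_semigroup ?E" "right_zero_semigroup ?E"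
    by (unfold_locales; simp)+
  moreover have "magma_iso (\<lambda>b. (b, b)) B (magma_prod ?E ?E)"
    using True by (simp add: magma_iso_def magma_prod_def bij_betw_def)
  ultimately show ?thesis
    using B unfolding rectangular_band_def by blast
next
  case False
  then obtain b0 where b0: "b0 \<in> carrier B" by blast
  have bij: "bij_betw f (carrier B) (carrier L \<times> carrier R)"
    and hom: "\<And>x y. \<lbrakk>x \<in> carrier B; y \<in> carrier B\<rbrakk>
      \<Longrightarrow> f (x \<cdot>\<^bsub>B\<^esub> y) = (fst (f x) \<cdot>\<^bsub>L\<^esub> fst (f y), snd (f x) \<cdot>\<^bsub>R\<^esub> snd (f y))"
    using f by (auto simp: magma_iso_def magma_prod_def)
  define l0 r0 where "l0 = fst (f b0)" and "r0 = snd (f b0)"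
  have mem: "fst (f x) \<in> carrier L" "snd (f x) \<in> carrier R" if "x \<in> carrier B" for x
    using bij that by (metis bij_betwE mem_Times_iff)+
  note b0_mem = mem[OF b0, folded l0_def r0_def]
  define g where "g = inv_into (carrier B) f"
  have g: "inj_on g (carrier L \<times> carrier R)"
    unfolding g_def using bij by (metis bij_betw_imp_inj_on bij_betw_inv_into)
  define i where "i l = g (l, r0)" for l
  define j where "j r = g (l0, r)" for r
  have i: "inj_on i (carrier L)" and j: "inj_on j (carrier R)"
    using g b0_mem unfolding i_def j_def inj_on_def by blast+
  let ?L = "\<lparr>carrier = i ` carrier L, mult = \<lambda>x y. x\<rparr>"
  let ?R = "\<lparr>carrier = j ` carrier R, mult = \<lambda>x y. y\<rparr>"
  have "left_zero_semigroup ?L" "right_zero_semigroup ?R"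
    by (unfold_locales; simp)+
  moreover have "magma_iso (map_prod i j \<circ> f) B (magma_prod ?L ?R)"
  proof -
    have "bij_betw (map_prod i j) (carrier L \<times> carrier R) (i ` carrier L \<times> j ` carrier R)"
      using i j by (simp add: bij_betw_def map_prod_inj_on map_prod_surj_on)
    from bij_betw_trans[OF bij this]
    have "bij_betw (map_prod i j \<circ> f) (carrier B) (i ` carrier L \<times> j ` carrier R)" .
    moreover have "(map_prod i j \<circ> f) (x \<cdot>\<^bsub>B\<^esub> y) = (i (fst (f x)), j (snd (f y)))"
      if "x \<in> carrier B" "y \<in> carrier B" for x y
      using that mem hom left_zero_semigroup.left_zero[OF L]
        right_zero_semigroup.right_zero[OF R] by simp
    ultimately show ?thesis
      by (simp add: magma_iso_def magma_prod_def)
  qed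
  ultimately show ?thesis
    using B unfolding rectangular_band_def by blast
qed

lemma rectangular_quasigroupI:
  fixes M :: "('a, 'm) algebra3_scheme"
    and Q :: "('q, 'n) algebra3_scheme" and B :: "('b, 'k) algebra3_scheme"
  assumes M: "algebra3 M" and Q: "quasigroup Q" and B: "rectangular_band_algebra B"
    and f: "algebra3_iso f M (algebra3_prod Q B)"
  shows "rectangular_quasigroup M"
proof (cases "carrier M = {}")
  case True
  let ?E = "\<lparr>carrier = {} :: 'a set, mult = \<lambda>x y. x, ldiv = \<lambda>x y. x, rdiv = \<lambda>x y. x\<rparr>"
  have Q': "quasigroup ?E" and "left_zero_semigroup ?E" "right_zero_semigroup ?E" "semigrp ?E"
    by (unfold_locales; simp)+
  moreover have "magma_iso (\<lambda>b. (b, b)) ?E (magma_prod ?E ?E)"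
    by (simp add: magma_iso_def magma_prod_def bij_betw_def)
  ultimately have "rectangular_band ?E"
    by (intro rectangular_bandI)
  then have "rectangular_band_algebra ?E"
    by (simp add: rectangular_band_algebra_def)
  moreover have "algebra3_iso (\<lambda>b. (b, b)) M (algebra3_prod ?E ?E)"
    using True by (simp add: algebra3_iso_def magma_iso_def algebra3_prod_def bij_betw_def)
  ultimately show ?thesis
    using M Q' unfolding rectangular_quasigroup_def by blast
next
  case False
  then obtain m0 where m0: "m0 \<in> carrier M" by blast
  have bij: "bij_betw f (carrier M) (carrier Q \<times> carrier B)"
    and hom: "\<And>x y. \<lbrakk>x \<in> carrier M; y \<in> carrier M\<rbrakk>
      \<Longrightarrow> f (x \<cdot>\<^bsub>M\<^esub> y) = (fst (f x) \<cdot>\<^bsub>Q\<^esub> fst (f y), snd (f x) \<cdot>\<^bsub>B\<^esub> snd (f y))"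
      "\<And>x y. \<lbrakk>x \<in> carrier M; y \<in> carrier M\<rbrakk>
      \<Longrightarrow> f (x \<setminus>\<^bsub>M\<^esub> y) = (fst (f x) \<setminus>\<^bsub>Q\<^esub> fst (f y), snd (f x) \<setminus>\<^bsub>B\<^esub> snd (f y))"
      "\<And>x y. \<lbrakk>x \<in> carrier M; y \<in> carrier M\<rbrakk>
      \<Longrightarrow> f (x \<oslash>\<^bsub>M\<^esub> y) = (fst (f x) \<oslash>\<^bsub>Q\<^esub> fst (f y), snd (f x) \<oslash>\<^bsub>B\<^esub> snd (f y))"
    using f by (auto simp: algebra3_iso_def magma_iso_def algebra3_prod_def)
  define q0 b0 where "q0 = fst (f m0)" and "b0 = snd (f m0)"
  have mem: "fst (f x) \<in> carrier Q" "snd (f x) \<in> carrier B" if "x \<in> carrier M" for x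
    using bij that by (metis bij_betwE mem_Times_iff)+
  note m0_mem = mem[OF m0, folded q0_def b0_def]
  define g where "g = inv_into (carrier M) f"
  have g: "inj_on g (carrier Q \<times> carrier B)"
    unfolding g_def using bij by (metis bij_betw_imp_inj_on bij_betw_inv_into)
  define i where "i q = g (q, b0)" for q
  define j where "j b = g (q0, b)" for b
  have i: "inj_on i (carrier Q)" and j: "inj_on j (carrier B)"
    using g m0_mem unfolding i_def j_def inj_on_def by blast+
  define i' where "i' = inv_into (carrier Q) i"
  define j' where "j' = inv_into (carrier B) j"
  have i' [simp]: "i' (i q) = q" if "q \<in> carrier Q" for q
    using i that by (simp add: i'_def)
  have j' [simp]: "j' (j b) = b" if "b \<in> carrier B" for b
    using j that by (simp add: j'_def)
  let ?Q = "\<lparr>carrier = i ` carrier Q, mult = \<lambda>x y. i (i' x \<cdot>\<^bsub>Q\<^esub> i' y),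
    ldiv = \<lambda>x y. i (i' x \<setminus>\<^bsub>Q\<^esub> i' y), rdiv = \<lambda>x y. i (i' x \<oslash>\<^bsub>Q\<^esub> i' y)\<rparr>"
  let ?B = "\<lparr>carrier = j ` carrier B, mult = \<lambda>x y. j (j' x \<cdot>\<^bsub>B\<^esub> j' y),
    ldiv = \<lambda>x y. j (j' x \<setminus>\<^bsub>B\<^esub> j' y), rdiv = \<lambda>x y. j (j' x \<oslash>\<^bsub>B\<^esub> j' y)\<rparr>"
  interpret Q: quasigroup Q by (rule Q)
  have Q': "quasigroup ?Q"
    by (unfold_locales; auto simp: Q.mult_closed Q.ldiv_closed Q.rdiv_closed
        Q.ldiv_mult Q.mult_ldiv Q.mult_rdiv Q.rdiv_mult)
  obtain L R :: "'b magma" and h where "semigrp B"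
    and LR: "left_zero_semigroup L" "right_zero_semigroup R"
    and h: "magma_iso h B (magma_prod L R)"
    and div: "\<And>x y. \<lbrakk>x \<in> carrier B; y \<in> carrier B\<rbrakk>
      \<Longrightarrow> x \<setminus>\<^bsub>B\<^esub> y = x \<cdot>\<^bsub>B\<^esub> y \<and> x \<oslash>\<^bsub>B\<^esub> y = x \<cdot>\<^bsub>B\<^esub> y"
    using B unfolding rectangular_band_algebra_def rectangular_band_def by blast
  interpret B: semigrp B by fact
  have B': "semigrp ?B"
    by (unfold_locales; auto simp: B.mult_closed B.mult_assoc)
  have "bij_betw j' (j ` carrier B) (carrier B)"
    using bij_betw_inv_into[of j "carrier B" "j ` carrier B"] j
    by (simp add: j'_def bij_betw_def)
  moreover have "bij_betw h (carrier B) (carrier L \<times> carrier R)"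
    using h by (simp add: magma_iso_def magma_prod_def)
  ultimately have "bij_betw (h \<circ> j') (j ` carrier B) (carrier L \<times> carrier R)"
    by (rule bij_betw_trans)
  then have "magma_iso (h \<circ> j') ?B (magma_prod L R)"
    using h by (auto simp: magma_iso_def magma_prod_def B.mult_closed)
  from rectangular_bandI[OF B' LR this] have "rectangular_band_algebra ?B"
    by (auto simp: rectangular_band_algebra_def div)
  moreover have "algebra3_iso (map_prod i j \<circ> f) M (algebra3_prod ?Q ?B)"
  proof -
    have "bij_betw (map_prod i j) (carrier Q \<times> carrier B) (i ` carrier Q \<times> j ` carrier B)"
      using i j by (simp add: bij_betw_def map_prod_inj_on map_prod_surj_on)
    from bij_betw_trans[OF bij this]
    have "bij_betw (map_prod i j \<circ> f) (carrier M) (i ` carrier Q \<times> j ` carrier B)" .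
    then show ?thesis
      by (simp add: algebra3_iso_def magma_iso_def algebra3_prod_def hom mem)
  qed
  ultimately show ?thesis
    using M Q' unfolding rectangular_quasigroup_def by blast
qed

end

theory Submission
  imports Defs
begin

text \<open>
  Write an element of a rectangular quasigroup as a triple \<open>(q, l, r)\<close> of its quasigroup, left zero
  and right zero coordinates.  Then \<open>x \<setminus> (x \<cdot> y)\<close> is \<open>y\<close> with its \<open>l\<close> replaced by that of \<open>x\<close>,
  and \<open>(x \<cdot> y) \<oslash> y\<close> is \<open>x\<close> with its \<open>r\<close> replaced by that of \<open>y\<close>.  The whole proof runs on these
  two derived operations, written \<open>x \<triangleright> y\<close> and \<open>x \<triangleleft> y\<close>.

  That rectangular quasigroups satisfy the identities is a matter of the factors alone: both kinds
  of factor satisfy them, and identities pass to products and to isomorphic copies.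

  For the converse, the identities imply that \<open>\<triangleright>\<close> and \<open>\<triangleleft>\<close> behave as the coordinates predict:
  each is a rectangular band operation, the two associate with each other
  (\<open>lshift_rshift_assoc\<close>), and a shift by \<open>\<triangleright>\<close> or \<open>\<triangleleft>\<close> is either absorbed by a neighbouring basic
  operation or can be pulled out of it.  Fixing a base point \<open>a\<close>, the coordinates of \<open>x\<close> are then
  recovered inside the algebra itself as
  \[ q = a \<triangleright> (x \<triangleleft> a), \quad l = x \<triangleright> a, \quad r = a \<triangleleft> x, \]
  and \<open>x = l \<triangleright> (q \<triangleleft> r)\<close> inverts this.  The elements \<open>q\<close> with \<open>a \<triangleright> q = q = q \<triangleleft> a\<close> form a subalgebra
  on which \<open>x \<triangleright> y = y\<close> and \<open>x \<triangleleft> y = x\<close>; it is a quasigroup, since \<open>x \<triangleright> y\<close> is both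
  \<open>x \<setminus> (x \<cdot> y)\<close> and \<open>x \<cdot> (x \<setminus> y)\<close>, and likewise for \<open>x \<triangleleft> y\<close>.

  The system of identities is invariant under reversing all products and exchanging the two
  divisions.  So each fact about \<open>\<triangleright>\<close> yields one about \<open>\<triangleleft>\<close>, through the opposite algebra.
\<close>

section \<open>The identities and the two shifts\<close>

locale rectangular_identities = algebra3 +
  assumes ldiv_square: "x \<in> carrier M \<Longrightarrow> x \<setminus> (x \<cdot> x) = x"
    and rdiv_square: "x \<in> carrier M \<Longrightarrow> (x \<cdot> x) \<oslash> x = x"
    and mult_ldiv: "\<lbrakk>x \<in> carrier M; y \<in> carrier M\<rbrakk> \<Longrightarrow> x \<cdot> (x \<setminus> y) = x \<setminus> (x \<cdot> y)"
    and rdiv_mult: "\<lbrakk>x \<in> carrier M; y \<in> carrier M\<rbrakk> \<Longrightarrow> (x \<oslash> y) \<cdot> y = (x \<cdot> y) \<oslash> y"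
    and ldiv_ldiv_mult: "\<lbrakk>x \<in> carrier M; y \<in> carrier M; z \<in> carrier M\<rbrakk>
      \<Longrightarrow> (x \<setminus> y) \<setminus> ((x \<setminus> y) \<cdot> z) = x \<setminus> (x \<cdot> z)"
    and mult_rdiv_rdiv: "\<lbrakk>x \<in> carrier M; y \<in> carrier M; z \<in> carrier M\<rbrakk>
      \<Longrightarrow> (x \<cdot> (y \<oslash> z)) \<oslash> (y \<oslash> z) = (x \<cdot> z) \<oslash> z"
    and ldiv_mult_mult: "\<lbrakk>x \<in> carrier M; y \<in> carrier M; z \<in> carrier M\<rbrakk>
      \<Longrightarrow> (x \<setminus> (x \<cdot> y)) \<cdot> z = x \<setminus> (x \<cdot> (y \<cdot> z))"
    and mult_mult_rdiv: "\<lbrakk>x \<in> carrier M; y \<in> carrier M; z \<in> carrier M\<rbrakk>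
      \<Longrightarrow> x \<cdot> ((y \<cdot> z) \<oslash> z) = ((x \<cdot> y) \<cdot> z) \<oslash> z"

definition lshift :: "('a, 'm) algebra3_scheme \<Rightarrow> 'a \<Rightarrow> 'a \<Rightarrow> 'a" (infixl "\<triangleright>\<index>" 65) where
  "x \<triangleright>\<^bsub>M\<^esub> y = x \<setminus>\<^bsub>M\<^esub> (x \<cdot>\<^bsub>M\<^esub> y)"

definition rshift :: "('a, 'm) algebra3_scheme \<Rightarrow> 'a \<Rightarrow> 'a \<Rightarrow> 'a" (infixl "\<triangleleft>\<index>" 65) where
  "x \<triangleleft>\<^bsub>M\<^esub> y = (x \<cdot>\<^bsub>M\<^esub> y) \<oslash>\<^bsub>M\<^esub> y"

definition opposite :: "('a, 'm) algebra3_scheme \<Rightarrow> 'a algebra3" where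
  "opposite M =
    \<lparr>carrier = carrier M, mult = (\<lambda>x y. y \<cdot>\<^bsub>M\<^esub> x),
     ldiv = (\<lambda>x y. y \<oslash>\<^bsub>M\<^esub> x), rdiv = (\<lambda>x y. y \<setminus>\<^bsub>M\<^esub> x)\<rparr>"

lemma opposite_simps:
  "carrier (opposite M) = carrier M"
  "x \<cdot>\<^bsub>opposite M\<^esub> y = y \<cdot>\<^bsub>M\<^esub> x"
  "x \<setminus>\<^bsub>opposite M\<^esub> y = y \<oslash>\<^bsub>M\<^esub> x"
  "x \<oslash>\<^bsub>opposite M\<^esub> y = y \<setminus>\<^bsub>M\<^esub> x"
  "x \<triangleright>\<^bsub>opposite M\<^esub> y = y \<triangleleft>\<^bsub>M\<^esub> x"
  "x \<triangleleft>\<^bsub>opposite M\<^esub> y = y \<triangleright>\<^bsub>M\<^esub> x"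
  by (simp_all add: opposite_def lshift_def rshift_def)

context rectangular_identities
begin

section \<open>Calculus of the shifts\<close>

lemma opposite_rectangular_identities: "rectangular_identities (opposite M)"
  by unfold_locales
    (simp_all add: opposite_simps mult_closed ldiv_closed rdiv_closed ldiv_square rdiv_square
      mult_ldiv rdiv_mult ldiv_ldiv_mult mult_rdiv_rdiv ldiv_mult_mult mult_mult_rdiv)

lemma lshift_closed [simp]: "\<lbrakk>x \<in> carrier M; y \<in> carrier M\<rbrakk> \<Longrightarrow> x \<triangleright> y \<in> carrier M"
  by (simp add: lshift_def mult_closed ldiv_closed)

lemma rshift_closed [simp]: "\<lbrakk>x \<in> carrier M; y \<in> carrier M\<rbrakk> \<Longrightarrow> x \<triangleleft> y \<in> carrier M"
  by (simp add: rshift_def mult_closed rdiv_closed)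

declare mult_closed [simp] ldiv_closed [simp] rdiv_closed [simp]

lemma lshift_idem [simp]: "x \<in> carrier M \<Longrightarrow> x \<triangleright> x = x"
  by (simp add: lshift_def ldiv_square)

lemma rshift_idem [simp]: "x \<in> carrier M \<Longrightarrow> x \<triangleleft> x = x"
  by (simp add: rshift_def rdiv_square)

lemma mult_ldiv_lshift: "\<lbrakk>x \<in> carrier M; y \<in> carrier M\<rbrakk> \<Longrightarrow> x \<cdot> (x \<setminus> y) = x \<triangleright> y"
  by (simp add: lshift_def mult_ldiv)

lemma ldiv_mult_lshift: "x \<setminus> (x \<cdot> y) = x \<triangleright> y"
  by (simp add: lshift_def)

lemma ldiv_lshift [simp]:
  "\<lbrakk>x \<in> carrier M; y \<in> carrier M; z \<in> carrier M\<rbrakk> \<Longrightarrow> (x \<setminus> y) \<triangleright> z = x \<triangleright> z"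
  by (simp add: lshift_def ldiv_ldiv_mult)

lemma lshift_mult: "\<lbrakk>x \<in> carrier M; y \<in> carrier M; z \<in> carrier M\<rbrakk> \<Longrightarrow> x \<triangleright> y \<cdot> z = (x \<triangleright> y) \<cdot> z"
  by (simp add: lshift_def ldiv_mult_mult)

lemma lshift_lshift_left [simp]:
  "\<lbrakk>x \<in> carrier M; y \<in> carrier M; z \<in> carrier M\<rbrakk> \<Longrightarrow> x \<triangleright> y \<triangleright> z = x \<triangleright> z"
  using ldiv_lshift[of x "x \<cdot> y" z] by (simp add: ldiv_mult_lshift)

lemma mult_lshift_self:
  assumes "x \<in> carrier M" "y \<in> carrier M"
  shows "x \<cdot> (x \<triangleright> y) = x \<cdot> y"
proof -
  have "x \<cdot> (x \<triangleright> y) = x \<triangleright> x \<cdot> y"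
    using assms mult_ldiv_lshift[of x "x \<cdot> y"] by (simp add: ldiv_mult_lshift)
  also have "\<dots> = x \<cdot> y"
    using assms by (simp add: lshift_mult)
  finally show ?thesis .
qed

text \<open>
  A product has the left coordinate of its first factor, because it is itself a left quotient by
  that factor: \<open>x \<cdot> y = x \<setminus> (x \<cdot> (x \<cdot> y))\<close>.
\<close>

lemma mult_lshift [simp]:
  assumes "x \<in> carrier M" "y \<in> carrier M" "z \<in> carrier M"
  shows "x \<cdot> y \<triangleright> z = x \<triangleright> z"
proof -
  have "x \<cdot> y = x \<setminus> (x \<cdot> (x \<cdot> y))"
    using assms by (simp add: ldiv_mult_lshift lshift_mult)
  then show ?thesis
    using assms by (metis ldiv_lshift mult_closed)
qed

text \<open>
  Multiplication by \<open>w = x \<triangleright> y\<close> on the left does not distinguish \<open>y \<triangleright> z\<close> from \<open>z\<close>, hence neither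
  does the operation \<open>w \<triangleright> _\<close>; but that is \<open>x \<triangleright> _\<close>.
\<close>

lemma lshift_lshift_right [simp]:
  assumes "x \<in> carrier M" "y \<in> carrier M" "z \<in> carrier M"
  shows "x \<triangleright> (y \<triangleright> z) = x \<triangleright> z"
proof -
  let ?w = "x \<triangleright> y"
  have "?w \<cdot> (y \<triangleright> z) = x \<triangleright> y \<cdot> (y \<triangleright> z)"
    using assms by (simp add: lshift_mult)
  also have "\<dots> = ?w \<cdot> z"
    using assms by (simp add: mult_lshift_self lshift_mult)
  finally have "?w \<triangleright> (y \<triangleright> z) = ?w \<triangleright> z"
    by (simp add: lshift_def)
  then show ?thesis
    using assms by simp
qed

lemma mult_absorb_lshift [simp]:
  assumes "x \<in> carrier M" "y \<in> carrier M" "z \<in> carrier M"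
  shows "x \<cdot> (y \<triangleright> z) = x \<cdot> z"
  using assms mult_lshift_self[of x "y \<triangleright> z"] by (simp add: mult_lshift_self)

lemma lshift_ldiv_self [simp]:
  "\<lbrakk>x \<in> carrier M; y \<in> carrier M\<rbrakk> \<Longrightarrow> x \<triangleright> x \<setminus> y = x \<setminus> y"
  by (metis ldiv_closed ldiv_lshift lshift_idem)

lemma ldiv_lshift_self:
  assumes "x \<in> carrier M" "y \<in> carrier M"
  shows "x \<setminus> (x \<triangleright> y) = x \<setminus> y"
  using assms ldiv_mult_lshift[of x "x \<setminus> y"] by (simp add: mult_ldiv_lshift)

lemma ldiv_absorb_lshift [simp]:
  assumes "x \<in> carrier M" "y \<in> carrier M" "z \<in> carrier M"
  shows "x \<setminus> (y \<triangleright> z) = x \<setminus> z"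
  using assms ldiv_lshift_self[of x "y \<triangleright> z"] by (simp add: ldiv_lshift_self)

text \<open>Both sides solve \<open>(x \<triangleright> y) \<cdot> u = x \<triangleright> z\<close> and have the left coordinate of \<open>x\<close>.\<close>

lemma lshift_ldiv:
  assumes "x \<in> carrier M" "y \<in> carrier M" "z \<in> carrier M"
  shows "x \<triangleright> y \<setminus> z = (x \<triangleright> y) \<setminus> z"
proof -
  let ?w = "x \<triangleright> y"
  have "?w \<cdot> (x \<triangleright> y \<setminus> z) = x \<triangleright> y \<cdot> (y \<setminus> z)"
    using assms by (simp add: lshift_mult)
  also have "\<dots> = x \<triangleright> z"
    using assms by (simp add: mult_ldiv_lshift)
  finally have "?w \<triangleright> (x \<triangleright> y \<setminus> z) = ?w \<setminus> (x \<triangleright> z)"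
    by (simp add: lshift_def)
  then show ?thesis
    using assms by simp
qed

section \<open>The mirror images\<close>

lemma rdiv_mult_rshift: "\<lbrakk>x \<in> carrier M; y \<in> carrier M\<rbrakk> \<Longrightarrow> (x \<oslash> y) \<cdot> y = x \<triangleleft> y"
  by (simp add: rshift_def rdiv_mult)

lemma rshift_rdiv [simp]:
  "\<lbrakk>x \<in> carrier M; y \<in> carrier M; z \<in> carrier M\<rbrakk> \<Longrightarrow> x \<triangleleft> y \<oslash> z = x \<triangleleft> z"
  by (simp add: rshift_def mult_rdiv_rdiv)

lemma mult_rshift: "\<lbrakk>x \<in> carrier M; y \<in> carrier M; z \<in> carrier M\<rbrakk> \<Longrightarrow> x \<cdot> y \<triangleleft> z = x \<cdot> (y \<triangleleft> z)"
  by (simp add: rshift_def mult_mult_rdiv)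

lemmas mirror =
  rectangular_identities.lshift_lshift_left[OF opposite_rectangular_identities, unfolded opposite_simps]
  rectangular_identities.mult_lshift[OF opposite_rectangular_identities, unfolded opposite_simps]
  rectangular_identities.lshift_lshift_right[OF opposite_rectangular_identities, unfolded opposite_simps]
  rectangular_identities.mult_absorb_lshift[OF opposite_rectangular_identities, unfolded opposite_simps]
  rectangular_identities.ldiv_absorb_lshift[OF opposite_rectangular_identities, unfolded opposite_simps]
  rectangular_identities.lshift_ldiv[OF opposite_rectangular_identities, unfolded opposite_simps]

lemma rshift_rshift_right [simp]:
  "\<lbrakk>x \<in> carrier M; y \<in> carrier M; z \<in> carrier M\<rbrakk> \<Longrightarrow> x \<triangleleft> (y \<triangleleft> z) = x \<triangleleft> z"
  by (rule mirror)

lemma rshift_rshift_left [simp]: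
  "\<lbrakk>x \<in> carrier M; y \<in> carrier M; z \<in> carrier M\<rbrakk> \<Longrightarrow> x \<triangleleft> y \<triangleleft> z = x \<triangleleft> z"
  by (rule mirror)

lemma rshift_mult [simp]:
  "\<lbrakk>x \<in> carrier M; y \<in> carrier M; z \<in> carrier M\<rbrakk> \<Longrightarrow> x \<triangleleft> y \<cdot> z = x \<triangleleft> z"
  by (rule mirror)

lemma mult_absorb_rshift [simp]:
  "\<lbrakk>x \<in> carrier M; y \<in> carrier M; z \<in> carrier M\<rbrakk> \<Longrightarrow> (x \<triangleleft> y) \<cdot> z = x \<cdot> z"
  by (rule mirror)

lemma rdiv_absorb_rshift [simp]:
  "\<lbrakk>x \<in> carrier M; y \<in> carrier M; z \<in> carrier M\<rbrakk> \<Longrightarrow> (x \<triangleleft> y) \<oslash> z = x \<oslash> z"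
  by (rule mirror)

lemma rdiv_rshift:
  "\<lbrakk>x \<in> carrier M; y \<in> carrier M; z \<in> carrier M\<rbrakk> \<Longrightarrow> x \<oslash> y \<triangleleft> z = x \<oslash> (y \<triangleleft> z)"
  by (rule mirror)

section \<open>Interaction of the two shifts\<close>

text \<open>
  The right coordinate of \<open>y \<triangleright> z\<close> is that of \<open>z\<close>, since the products \<open>y \<cdot> (y \<triangleright> z)\<close> and \<open>y \<cdot> z\<close>
  agree and a product has the right coordinate of its second factor.
\<close>

lemma rshift_lshift [simp]:
  assumes "x \<in> carrier M" "y \<in> carrier M" "z \<in> carrier M"
  shows "x \<triangleleft> (y \<triangleright> z) = x \<triangleleft> z"
proof -
  have "x \<triangleleft> (y \<triangleright> z) = x \<triangleleft> y \<cdot> (y \<triangleright> z)"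
    using assms by (simp del: mult_absorb_lshift)
  then show ?thesis
    using assms by simp
qed

lemma rshift_ldiv [simp]:
  assumes "x \<in> carrier M" "y \<in> carrier M" "z \<in> carrier M"
  shows "x \<triangleleft> y \<setminus> z = x \<triangleleft> z"
  using assms rshift_mult[of x y "y \<setminus> z"] by (simp add: mult_ldiv_lshift)

lemma lshift_rshift_left [simp]:
  "\<lbrakk>x \<in> carrier M; y \<in> carrier M; z \<in> carrier M\<rbrakk> \<Longrightarrow> x \<triangleleft> y \<triangleright> z = x \<triangleright> z"
  by (rule rectangular_identities.rshift_lshift
      [OF opposite_rectangular_identities, unfolded opposite_simps])

text \<open>
  Both sides give the same product with \<open>z\<close> on the right, so they agree after \<open>_ \<triangleleft> z\<close>; and both
  already have the right coordinate of \<open>z\<close>.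
\<close>

lemma lshift_rshift_assoc:
  assumes "x \<in> carrier M" "y \<in> carrier M" "z \<in> carrier M"
  shows "x \<triangleright> y \<triangleleft> z = x \<triangleright> (y \<triangleleft> z)"
proof -
  let ?u = "x \<triangleright> (y \<triangleleft> z)"
  have "?u \<cdot> z = x \<triangleright> (y \<triangleleft> z) \<cdot> z"
    using assms by (simp add: lshift_mult del: mult_absorb_rshift)
  also have "\<dots> = (x \<triangleright> y) \<cdot> z"
    using assms by (simp add: lshift_mult)
  finally have "?u \<triangleleft> z = x \<triangleright> y \<triangleleft> z"
    by (simp add: rshift_def)
  moreover have "?u \<triangleleft> z = ?u"
  proof -
    have "?u \<triangleleft> z = ?u \<triangleleft> ?u"
      using assms by (simp del: rshift_idem)
    then show ?thesis
      using assms by (simp del: rshift_lshift)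
  qed
  ultimately show ?thesis
    by simp
qed

text \<open>Both sides solve \<open>x \<cdot> u = x \<triangleright> (y \<triangleleft> z)\<close> and have the left coordinate of \<open>x\<close>.\<close>

lemma ldiv_rshift:
  assumes "x \<in> carrier M" "y \<in> carrier M" "z \<in> carrier M"
  shows "x \<setminus> y \<triangleleft> z = x \<setminus> (y \<triangleleft> z)"
proof -
  have "x \<cdot> (x \<setminus> y \<triangleleft> z) = x \<triangleright> (y \<triangleleft> z)"
    using assms by (simp add: mult_rshift[symmetric] mult_ldiv_lshift lshift_rshift_assoc)
  then have "x \<triangleright> (x \<setminus> y \<triangleleft> z) = x \<setminus> (x \<triangleright> (y \<triangleleft> z))"
    by (simp add: lshift_def)
  moreover have "x \<triangleright> (x \<setminus> y \<triangleleft> z) = x \<setminus> y \<triangleleft> z"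
    using assms by (simp add: lshift_rshift_assoc[symmetric])
  ultimately show ?thesis
    using assms by simp
qed

lemma ldiv_absorb_rshift [simp]:
  assumes "x \<in> carrier M" "y \<in> carrier M" "z \<in> carrier M"
  shows "(x \<triangleleft> y) \<setminus> z = x \<setminus> z"
proof -
  let ?w = "x \<triangleleft> y"
  have "?w \<cdot> (x \<setminus> z) = x \<triangleright> z"
    using assms by (simp add: mult_ldiv_lshift)
  then have "?w \<triangleright> x \<setminus> z = ?w \<setminus> (x \<triangleright> z)"
    by (simp add: lshift_def)
  then show ?thesis
    using assms by simp
qed

lemma lshift_rdiv:
  "\<lbrakk>x \<in> carrier M; y \<in> carrier M; z \<in> carrier M\<rbrakk> \<Longrightarrow> x \<triangleright> y \<oslash> z = (x \<triangleright> y) \<oslash> z"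
  by (rule rectangular_identities.ldiv_rshift
      [OF opposite_rectangular_identities, unfolded opposite_simps])

lemma rdiv_absorb_lshift [simp]:
  "\<lbrakk>x \<in> carrier M; y \<in> carrier M; z \<in> carrier M\<rbrakk> \<Longrightarrow> x \<oslash> (y \<triangleright> z) = x \<oslash> z"
  by (rule rectangular_identities.ldiv_absorb_rshift
      [OF opposite_rectangular_identities, unfolded opposite_simps])

lemma lshift_rdiv_left [simp]:
  "\<lbrakk>x \<in> carrier M; y \<in> carrier M; z \<in> carrier M\<rbrakk> \<Longrightarrow> x \<oslash> y \<triangleright> z = x \<triangleright> z"
  by (rule rectangular_identities.rshift_ldiv
      [OF opposite_rectangular_identities, unfolded opposite_simps])

section \<open>The coordinates\<close>

definition quasigroup_part :: "'a \<Rightarrow> 'a set" where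
  "quasigroup_part a = {q \<in> carrier M. a \<triangleright> q = q \<and> q \<triangleleft> a = q}"

definition quasigroup_coord :: "'a \<Rightarrow> 'a \<Rightarrow> 'a" where
  "quasigroup_coord a x = a \<triangleright> x \<triangleleft> a"

lemma quasigroup_coord_eq:
  "\<lbrakk>a \<in> carrier M; x \<in> carrier M\<rbrakk> \<Longrightarrow> quasigroup_coord a x = a \<triangleright> (x \<triangleleft> a)"
  by (simp add: quasigroup_coord_def lshift_rshift_assoc)

text \<open>
  The two ways of bracketing \<open>a \<triangleright> x \<triangleleft> a\<close> are used for different operands: the shift that is
  outermost must be one that the operation absorbs, which is \<open>\<triangleleft>\<close> on the left and \<open>\<triangleright>\<close> on the right.
\<close>

lemma quasigroup_coord_mult:
  assumes "a \<in> carrier M" "x \<in> carrier M" "y \<in> carrier M"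
  shows "quasigroup_coord a (x \<cdot> y) = quasigroup_coord a x \<cdot> quasigroup_coord a y"
  using assms quasigroup_coord_eq[of a y]
  by (simp add: quasigroup_coord_def[of a x] quasigroup_coord_def[of a "x \<cdot> y"] lshift_mult mult_rshift)

lemma quasigroup_coord_ldiv:
  assumes "a \<in> carrier M" "x \<in> carrier M" "y \<in> carrier M"
  shows "quasigroup_coord a (x \<setminus> y) = quasigroup_coord a x \<setminus> quasigroup_coord a y"
  using assms quasigroup_coord_eq[of a y]
  by (simp add: quasigroup_coord_def[of a x] quasigroup_coord_def[of a "x \<setminus> y"] lshift_ldiv ldiv_rshift)

lemma quasigroup_coord_rdiv:
  assumes "a \<in> carrier M" "x \<in> carrier M" "y \<in> carrier M"
  shows "quasigroup_coord a (x \<oslash> y) = quasigroup_coord a x \<oslash> quasigroup_coord a y"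
  using assms quasigroup_coord_eq[of a y]
  by (simp add: quasigroup_coord_def[of a x] quasigroup_coord_def[of a "x \<oslash> y"] lshift_rdiv rdiv_rshift)

lemma quasigroup_coord_in_part:
  "\<lbrakk>a \<in> carrier M; x \<in> carrier M\<rbrakk> \<Longrightarrow> quasigroup_coord a x \<in> quasigroup_part a"
  by (simp add: quasigroup_part_def quasigroup_coord_def lshift_rshift_assoc)

lemma quasigroup_coord_of_part: "q \<in> quasigroup_part a \<Longrightarrow> quasigroup_coord a q = q"
  by (simp add: quasigroup_part_def quasigroup_coord_def)

text \<open>
  The part is the fixed set of the homomorphism \<open>quasigroup_coord a\<close>, hence a subalgebra.  All its
  elements have the left and the right coordinate of \<open>a\<close>, so the shifts are trivial on it.
\<close>

lemma quasigroup_quasigroup_part: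
  assumes a: "a \<in> carrier M"
  shows "quasigroup (M\<lparr>carrier := quasigroup_part a\<rparr>)" (is "quasigroup ?Q")
proof -
  have carrier: "x \<in> carrier M" if "x \<in> quasigroup_part a" for x
    using that by (simp add: quasigroup_part_def)
  have lshift: "x \<triangleright> y = y" if "x \<in> quasigroup_part a" "y \<in> quasigroup_part a" for x y
    using that a lshift_lshift_left[of a x y] by (simp add: quasigroup_part_def)
  have rshift: "x \<triangleleft> y = x" if "x \<in> quasigroup_part a" "y \<in> quasigroup_part a" for x y
    using that a rshift_rshift_right[of x y a] by (simp add: quasigroup_part_def)
  have closed: "x \<cdot> y \<in> quasigroup_part a" "x \<setminus> y \<in> quasigroup_part a"
      "x \<oslash> y \<in> quasigroup_part a"
    if "x \<in> quasigroup_part a" "y \<in> quasigroup_part a" for x y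
    using that a quasigroup_coord_in_part[of a "x \<cdot> y"] quasigroup_coord_in_part[of a "x \<setminus> y"]
      quasigroup_coord_in_part[of a "x \<oslash> y"]
    by (simp_all add: carrier quasigroup_coord_of_part quasigroup_coord_mult
        quasigroup_coord_ldiv quasigroup_coord_rdiv)
  show ?thesis
    by unfold_locales
      (simp_all add: closed carrier mult_ldiv_lshift rdiv_mult_rshift lshift rshift
        ldiv_mult_lshift rshift_def[symmetric])
qed

definition left_part :: "'a \<Rightarrow> 'a set" where
  "left_part a = {l \<in> carrier M. l \<triangleright> a = l}"

definition right_part :: "'a \<Rightarrow> 'a set" where
  "right_part a = {r \<in> carrier M. a \<triangleleft> r = r}"

lemma bij_betw_coordinates:
  assumes a: "a \<in> carrier M"
  shows "bij_betw (\<lambda>x. (quasigroup_coord a x, x \<triangleright> a, a \<triangleleft> x)) (carrier M)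
    (quasigroup_part a \<times> left_part a \<times> right_part a)"
proof (rule bij_betw_byWitness[where f' = "\<lambda>(q, l, r). l \<triangleright> q \<triangleleft> r"])
  show "\<forall>x\<in>carrier M. (\<lambda>(q, l, r). l \<triangleright> q \<triangleleft> r) (quasigroup_coord a x, x \<triangleright> a, a \<triangleleft> x) = x"
    using a by (simp add: quasigroup_coord_def lshift_rshift_assoc)
  show "\<forall>t\<in>quasigroup_part a \<times> left_part a \<times> right_part a.
    (\<lambda>x. (quasigroup_coord a x, x \<triangleright> a, a \<triangleleft> x)) ((\<lambda>(q, l, r). l \<triangleright> q \<triangleleft> r) t) = t"
    using a by (auto simp: quasigroup_part_def left_part_def right_part_def quasigroup_coord_def
        lshift_rshift_assoc)
  show "(\<lambda>x. (quasigroup_coord a x, x \<triangleright> a, a \<triangleleft> x)) ` carrier M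
    \<subseteq> quasigroup_part a \<times> left_part a \<times> right_part a"
    using a by (auto simp: quasigroup_coord_in_part left_part_def right_part_def)
  show "(\<lambda>(q, l, r). l \<triangleright> q \<triangleleft> r) ` (quasigroup_part a \<times> left_part a \<times> right_part a) \<subseteq> carrier M"
    by (auto simp: quasigroup_part_def left_part_def right_part_def)
qed

end

section \<open>Rectangular bands as algebras\<close>

definition band_algebra :: "'l set \<Rightarrow> 'r set \<Rightarrow> ('l \<times> 'r) algebra3" where
  "band_algebra L R =
    \<lparr>carrier = L \<times> R, mult = (\<lambda>p q. (fst p, snd q)),
     ldiv = (\<lambda>p q. (fst p, snd q)), rdiv = (\<lambda>p q. (fst p, snd q))\<rparr>"

lemma rectangular_band_algebra_band_algebra: "rectangular_band_algebra (band_algebra L R)"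
proof -
  let ?L = "\<lparr>carrier = L, mult = \<lambda>x y. x\<rparr>" and ?R = "\<lparr>carrier = R, mult = \<lambda>x y. y\<rparr>"
  have "semigrp (band_algebra L R)" "left_zero_semigroup ?L" "right_zero_semigroup ?R"
    by (unfold_locales; auto simp: band_algebra_def)+
  moreover have "magma_iso id (band_algebra L R) (magma_prod ?L ?R)"
    by (simp add: magma_iso_def magma_prod_def band_algebra_def)
  ultimately show ?thesis
    by (auto simp: rectangular_band_algebra_def band_algebra_def intro: rectangular_bandI)
qed

lemma rectangular_identities_imp_rectangular_quasigroup:
  assumes "rectangular_identities M"
  shows "rectangular_quasigroup M"
proof (cases "carrier M = {}")
  \<comment> \<open>There is no base point, but every identity holds vacuously.\<close>
  case True
  have "algebra3 M"
    using True by unfold_locales simp_all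
  moreover have "quasigroup M"
    using True by unfold_locales simp_all
  moreover have "algebra3_iso (\<lambda>x. (x, undefined)) M (algebra3_prod M (band_algebra {} {}))"
    using True by (simp add: algebra3_iso_def magma_iso_def algebra3_prod_def bij_betw_def)
  ultimately show ?thesis
    by (intro rectangular_quasigroupI[OF _ _ rectangular_band_algebra_band_algebra])
next
  case False
  then obtain a where a: "a \<in> carrier M"
    by blast
  interpret rectangular_identities M
    by (rule assms)
  have "algebra3_iso (\<lambda>x. (quasigroup_coord a x, x \<triangleright>\<^bsub>M\<^esub> a, a \<triangleleft>\<^bsub>M\<^esub> x)) M
    (algebra3_prod (M\<lparr>carrier := quasigroup_part a\<rparr>) (band_algebra (left_part a) (right_part a)))"
    using a bij_betw_coordinates[OF a]
    by (simp add: algebra3_iso_def magma_iso_def algebra3_prod_def band_algebra_def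
        quasigroup_coord_mult quasigroup_coord_ldiv quasigroup_coord_rdiv)
  with algebra3_axioms quasigroup_quasigroup_part[OF a] rectangular_band_algebra_band_algebra
  show ?thesis
    by (rule rectangular_quasigroupI)
qed

section \<open>Rectangular quasigroups satisfy the identities\<close>

lemma rectangular_identities_quasigroup:
  assumes "quasigroup Q"
  shows "rectangular_identities Q"
proof -
  interpret quasigroup Q
    by (rule assms)
  show ?thesis
    by unfold_locales (simp_all add: mult_closed ldiv_closed rdiv_closed
        ldiv_mult mult_ldiv mult_rdiv rdiv_mult)
qed

lemma rectangular_identities_prod:
  assumes "rectangular_identities M" "rectangular_identities N"
  shows "rectangular_identities (algebra3_prod M N)"
proof -
  interpret M: rectangular_identities M
    by (rule assms)
  interpret N: rectangular_identities N
    by (rule assms)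
  show ?thesis
    by unfold_locales (auto simp: algebra3_prod_def M.ldiv_square N.ldiv_square M.rdiv_square
        N.rdiv_square M.mult_ldiv N.mult_ldiv M.rdiv_mult N.rdiv_mult
        M.ldiv_ldiv_mult N.ldiv_ldiv_mult M.mult_rdiv_rdiv N.mult_rdiv_rdiv
        M.ldiv_mult_mult N.ldiv_mult_mult M.mult_mult_rdiv N.mult_mult_rdiv)
qed

lemma rectangular_identities_iso:
  assumes "algebra3 M" and N: "rectangular_identities N" and f: "algebra3_iso f M N"
  shows "rectangular_identities M"
proof -
  interpret algebra3 M
    by (rule assms)
  interpret N: rectangular_identities N
    by (rule N)
  have inj: "x = y" if "f x = f y" "x \<in> carrier M" "y \<in> carrier M" for x y
    using f that by (auto simp: algebra3_iso_def magma_iso_def bij_betw_def inj_on_def)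
  have mem: "f x \<in> carrier N" if "x \<in> carrier M" for x
    using f that by (auto simp: algebra3_iso_def magma_iso_def bij_betw_def)
  have hom: "f (x \<cdot>\<^bsub>M\<^esub> y) = f x \<cdot>\<^bsub>N\<^esub> f y" "f (x \<setminus>\<^bsub>M\<^esub> y) = f x \<setminus>\<^bsub>N\<^esub> f y"
      "f (x \<oslash>\<^bsub>M\<^esub> y) = f x \<oslash>\<^bsub>N\<^esub> f y" if "x \<in> carrier M" "y \<in> carrier M" for x y
    using f that by (auto simp: algebra3_iso_def magma_iso_def)
  show ?thesis
    by unfold_locales (rule inj; simp add: mem hom mult_closed ldiv_closed rdiv_closed
        N.ldiv_square N.rdiv_square N.mult_ldiv N.rdiv_mult N.ldiv_ldiv_mult N.mult_rdiv_rdiv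
        N.ldiv_mult_mult N.mult_mult_rdiv)+
qed

text \<open>
  In coordinates, every side of an identity has the left coordinate of its first and the right
  coordinate of its last variable.
\<close>

lemma rectangular_identities_band:
  assumes B: "rectangular_band_algebra B"
  shows "rectangular_identities B"
proof -
  obtain L R :: "'a magma" and f where L: "left_zero_semigroup L" and R: "right_zero_semigroup R"
    and "semigrp B" and f: "magma_iso f B (magma_prod L R)"
    using B unfolding rectangular_band_algebra_def rectangular_band_def by blast
  interpret semigrp B
    by fact
  have div: "x \<setminus>\<^bsub>B\<^esub> y = x \<cdot>\<^bsub>B\<^esub> y" "x \<oslash>\<^bsub>B\<^esub> y = x \<cdot>\<^bsub>B\<^esub> y" if "x \<in> carrier B" "y \<in> carrier B" for x y
    using B that by (simp_all add: rectangular_band_algebra_def)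
  have "algebra3 B"
    by unfold_locales (simp_all add: div mult_closed)
  have bij: "bij_betw f (carrier B) (carrier L \<times> carrier R)"
    using f by (simp add: magma_iso_def magma_prod_def)
  have mem: "fst (f x) \<in> carrier L" "snd (f x) \<in> carrier R" if "x \<in> carrier B" for x
    using bij that by (metis bij_betwE mem_Times_iff)+
  have "f (x \<cdot>\<^bsub>B\<^esub> y) = (fst (f x), snd (f y))" if "x \<in> carrier B" "y \<in> carrier B" for x y
    using f that mem left_zero_semigroup.left_zero[OF L] right_zero_semigroup.right_zero[OF R]
    by (simp add: magma_iso_def magma_prod_def)
  with bij have iso: "algebra3_iso f B (band_algebra (carrier L) (carrier R))"
    by (simp add: algebra3_iso_def magma_iso_def band_algebra_def div)
  have "rectangular_identities (band_algebra (carrier L) (carrier R))"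
    by unfold_locales (auto simp: band_algebra_def)
  with \<open>algebra3 B\<close> show ?thesis
    using iso by (rule rectangular_identities_iso)
qed

lemma rectangular_quasigroup_imp_rectangular_identities:
  assumes "rectangular_quasigroup M"
  shows "rectangular_identities M"
proof -
  obtain Q B :: "'a algebra3" and f where "algebra3 M" and Q: "quasigroup Q"
    and B: "rectangular_band_algebra B" and f: "algebra3_iso f M (algebra3_prod Q B)"
    using assms unfolding rectangular_quasigroup_def by blast
  from rectangular_identities_quasigroup[OF Q] rectangular_identities_band[OF B]
  have "rectangular_identities (algebra3_prod Q B)"
    by (rule rectangular_identities_prod)
  with \<open>algebra3 M\<close> show ?thesis
    using f by (rule rectangular_identities_iso)
qed

theorem theorem3p6:
  fixes M :: "'a algebra3" (structure)
  assumes "algebra3 M"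
  shows "rectangular_quasigroup M \<longleftrightarrow>
    (\<forall>x\<in>carrier M. \<forall>y\<in>carrier M. \<forall>z\<in>carrier M.
      x \<setminus> (x \<cdot> x) = x \<and>
      (x \<cdot> x) \<oslash> x = x \<and>
      x \<cdot> (x \<setminus> y) = x \<setminus> (x \<cdot> y) \<and>
      (x \<oslash> y) \<cdot> y = (x \<cdot> y) \<oslash> y \<and>
      (x \<setminus> y) \<setminus> ((x \<setminus> y) \<cdot> z) = x \<setminus> (x \<cdot> z) \<and>
      (x \<cdot> (y \<oslash> z)) \<oslash> (y \<oslash> z) = (x \<cdot> z) \<oslash> z \<and>
      (x \<setminus> (x \<cdot> y)) \<cdot> z = x \<setminus> (x \<cdot> (y \<cdot> z)) \<and>
      x \<cdot> ((y \<cdot> z) \<oslash> z) = ((x \<cdot> y) \<cdot> z) \<oslash> z)"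
  (is "_ \<longleftrightarrow> ?identities")
proof -
  have "rectangular_quasigroup M \<longleftrightarrow> rectangular_identities M"
    using rectangular_quasigroup_imp_rectangular_identities
      rectangular_identities_imp_rectangular_quasigroup by blast
  also have "\<dots> \<longleftrightarrow> ?identities"
  proof
    assume "rectangular_identities M"
    then interpret rectangular_identities M .
    show ?identities
      by (intro ballI conjI ldiv_square rdiv_square mult_ldiv rdiv_mult ldiv_ldiv_mult
          mult_rdiv_rdiv ldiv_mult_mult mult_mult_rdiv)
  next
    assume ?identities
    with assms show "rectangular_identities M"
      by (intro rectangular_identities.intro rectangular_identities_axioms.intro) meson+
  qed
  finally show ?thesis .
qed

end
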